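(* Let $\mathcal{E}$ be a complete totally ordered family of partial isometries on a complex Hilbert space $H$, and let $$\mathcal{A}_{\mathcal{E}}=\{T\in B(H)\colon (I-Q_E)TP_E=0\text{ for all }E\in\mathcal{E}\}.$$ Let $x,y\in H$ be such that there exist $E_0,F_0\in\mathcal{E}$ with $x\in\operatorname{ran}(P_{E_0})$ and $y\in\operatorname{ran}(Q_{F_0})$. The following assertions are equivalent. (i) There exists an operator $T\in\mathcal{A}_{\mathcal{E}}$ such that $Tx=y$. (ii) $$K=\sup_{E\in\mathcal{E}}\frac{\|(I-Q_E)y\|}{\|(I-P_E)x\|}<\infty,$$ where the quotient is taken to be $0$ if $(I-Q_E)y=0=(I-P_E)x$, and $\infty$ if $(I-Q_E)y\ne0$ and $(I-P_E)x=0$. Under these conditions, $T$ can be chosen with $\|T\|=K$. Furthermore, if $S\in\mathcal{A}_{\mathcal{E}}$ is such that $Sx=y$, then $\|S\|\ge K$.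
   Context: $B(H)$ is the set of bounded linear operators on $H$ and $I$ is the identity operator. A partial isometry is $V\in B(H)$ with $\|Vx\|=\|x\|$ for all $x\in\ker(V)^\perp$; its initial space is $\ker(V)^\perp$ and its final space is $\operatorname{ran}(V)$. $P_V=V^*V$ and $Q_V=VV^*$ are the orthogonal projections onto the initial and final spaces. Partial isometries are ordered by the Halmos--McLaughlin ordering: $E\le F$ if $F(x)=E(x)$ for all $x$ in the initial space of $E$ (so that the initial space of $E$ is contained in that of $F$). A family of partial isometries is complete if it contains $0$ and, for every nonempty subset of it, the supremum and infimum (in the poset of all partial isometries on $H$) exist and lie in the family. $\mathcal{A}_{\mathcal{E}}$ is not assumed here to be an algebra. *)

theory Defs
  imports "HOL-Analysis.Analysis"
begin

text \<open>
  Complex Hilbert spaces. The class extends the real class \<^class>\<open>real_inner\<close>: the underlying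
  real structure of a complex Hilbert space is the real part of its inner product. Thus norm and
  topology are the library ones, and positive definiteness of \<open>cinner\<close> and the unit law
  of \<open>scaleC\<close> are inherited. The inner product is linear in its first argument.
\<close>

class complex_hilbert_space = real_inner + banach +
  fixes scaleC :: "complex \<Rightarrow> 'a \<Rightarrow> 'a" (infixr \<open>*\<^sub>C\<close> 75)
    and cinner :: "'a \<Rightarrow> 'a \<Rightarrow> complex"
  assumes scaleC_of_real: "complex_of_real r *\<^sub>C x = r *\<^sub>R x"
    and scaleC_add_right: "c *\<^sub>C (x + y) = c *\<^sub>C x + c *\<^sub>C y"
    and scaleC_add_left: "(c + d) *\<^sub>C x = c *\<^sub>C x + d *\<^sub>C x"
    and scaleC_scaleC: "c *\<^sub>C (d *\<^sub>C x) = (c * d) *\<^sub>C x"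
    and cinner_commute: "cinner x y = cnj (cinner y x)"
    and cinner_add_left: "cinner (x + y) z = cinner x z + cinner y z"
    and cinner_scaleC_left: "cinner (c *\<^sub>C x) y = c * cinner x y"
    and inner_eq_Re_cinner: "x \<bullet> y = Re (cinner x y)"

instantiation complex :: complex_hilbert_space
begin

definition scaleC_complex :: "complex \<Rightarrow> complex \<Rightarrow> complex"
  where "scaleC_complex c z = c * z"

definition cinner_complex :: "complex \<Rightarrow> complex \<Rightarrow> complex"
  where "cinner_complex z w = z * cnj w"

instance
  by standard
    (simp_all add: scaleC_complex_def cinner_complex_def scaleR_conv_of_real
      inner_complex_def algebra_simps)

end

text \<open>The bounded complex-linear operators \<open>B(H)\<close>; their norm is \<^const>\<open>onorm\<close>.\<close>

definition bounded_operators :: "('a::complex_hilbert_space \<Rightarrow> 'a) set"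
  where "bounded_operators = {T. bounded_linear T \<and> (\<forall>c v. T (c *\<^sub>C v) = c *\<^sub>C T v)}"

definition corthogonal_comp :: "'a::complex_hilbert_space set \<Rightarrow> 'a set"
  where "corthogonal_comp S = {v. \<forall>s\<in>S. cinner v s = 0}"

text \<open>
  The adjoint is unique whenever it exists (see \<open>cadjoint_eqI\<close>), and it exists for every
  element of \<open>B(H)\<close> by the Riesz representation theorem; elsewhere the value is arbitrary.
\<close>

definition cadjoint :: "('a::complex_hilbert_space \<Rightarrow> 'a) \<Rightarrow> 'a \<Rightarrow> 'a"
  where "cadjoint V = (THE W. \<forall>v w. cinner (V v) w = cinner v (W w))"

lemma cinner_ext:
  fixes a b :: "'a::complex_hilbert_space"
  assumes "\<And>v. cinner v a = cinner v b"
  shows "a = b"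
proof -
  have "v \<bullet> a = v \<bullet> b" for v
    by (simp only: inner_eq_Re_cinner assms)
  then show ?thesis
    using vector_eq_ldot[of a b] by blast
qed

lemma cadjoint_eqI:
  assumes "\<And>v w. cinner (V v) w = cinner v (W w)"
  shows "cadjoint V = W"
  unfolding cadjoint_def
proof (rule the_equality)
  fix W' assume W': "\<forall>v w. cinner (V v) w = cinner v (W' w)"
  have "cinner v (W' w) = cinner v (W w)" for v w
    using trans[OF W'[rule_format, of v w, symmetric] assms] .
  then have "W' w = W w" for w
    by (rule cinner_ext)
  then show "W' = W"
    by (rule ext)
qed (intro allI assms)

definition initial_space :: "('a::complex_hilbert_space \<Rightarrow> 'a) \<Rightarrow> 'a set"
  where "initial_space V = corthogonal_comp {v. V v = 0}"

definition partial_isometry :: "('a::complex_hilbert_space \<Rightarrow> 'a) \<Rightarrow> bool"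
  where "partial_isometry V \<longleftrightarrow>
    V \<in> bounded_operators \<and> (\<forall>v\<in>initial_space V. norm (V v) = norm v)"

definition initial_proj :: "('a::complex_hilbert_space \<Rightarrow> 'a) \<Rightarrow> 'a \<Rightarrow> 'a"
  where "initial_proj V = cadjoint V \<circ> V"

definition final_proj :: "('a::complex_hilbert_space \<Rightarrow> 'a) \<Rightarrow> 'a \<Rightarrow> 'a"
  where "final_proj V = V \<circ> cadjoint V"

text \<open>The Halmos--McLaughlin ordering, meant for partial isometries only.\<close>

definition hm_le :: "('a::complex_hilbert_space \<Rightarrow> 'a) \<Rightarrow> ('a \<Rightarrow> 'a) \<Rightarrow> bool"
  where "hm_le E F \<longleftrightarrow> (\<forall>v\<in>initial_space E. F v = E v)"

definition hm_is_sup :: "('a::complex_hilbert_space \<Rightarrow> 'a) set \<Rightarrow> ('a \<Rightarrow> 'a) \<Rightarrow> bool"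
  where "hm_is_sup S U \<longleftrightarrow> partial_isometry U \<and> (\<forall>E\<in>S. hm_le E U) \<and>
    (\<forall>W. partial_isometry W \<and> (\<forall>E\<in>S. hm_le E W) \<longrightarrow> hm_le U W)"

definition hm_is_inf :: "('a::complex_hilbert_space \<Rightarrow> 'a) set \<Rightarrow> ('a \<Rightarrow> 'a) \<Rightarrow> bool"
  where "hm_is_inf S U \<longleftrightarrow> partial_isometry U \<and> (\<forall>E\<in>S. hm_le U E) \<and>
    (\<forall>W. partial_isometry W \<and> (\<forall>E\<in>S. hm_le W E) \<longrightarrow> hm_le W U)"

definition complete_family :: "('a::complex_hilbert_space \<Rightarrow> 'a) set \<Rightarrow> bool"
  where "complete_family \<E> \<longleftrightarrow> (\<forall>E\<in>\<E>. partial_isometry E) \<and> (\<lambda>_. 0) \<in> \<E> \<and>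
    (\<forall>S. S \<subseteq> \<E> \<and> S \<noteq> {} \<longrightarrow> (\<exists>U\<in>\<E>. hm_is_sup S U) \<and> (\<exists>U\<in>\<E>. hm_is_inf S U))"

definition totally_ordered_family :: "('a::complex_hilbert_space \<Rightarrow> 'a) set \<Rightarrow> bool"
  where "totally_ordered_family \<E> \<longleftrightarrow> (\<forall>E\<in>\<E>. \<forall>F\<in>\<E>. hm_le E F \<or> hm_le F E)"

text \<open>The condition \<open>(I - Q\<^sub>E) T P\<^sub>E = 0\<close> is written pointwise.\<close>

definition family_operators ::
    "('a::complex_hilbert_space \<Rightarrow> 'a) set \<Rightarrow> ('a \<Rightarrow> 'a) set"
  where "family_operators \<E> = {T \<in> bounded_operators.
    \<forall>E\<in>\<E>. \<forall>v. T (initial_proj E v) - final_proj E (T (initial_proj E v)) = 0}"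

definition ext_quotient :: "real \<Rightarrow> real \<Rightarrow> ereal"
  where "ext_quotient a b =
    (if b = 0 then (if a = 0 then 0 else \<infinity>) else ereal (a / b))"

end

theory Submission
  imports Defs
begin

text \<open>
  Write \<open>a\<^sub>E = (I - P\<^sub>E) x\<close> and \<open>b\<^sub>E = (I - Q\<^sub>E) y\<close> for \<open>E \<in> \<E>\<close>. If \<open>S\<close> satisfies
  \<open>(I - Q\<^sub>E) S P\<^sub>E = 0\<close> and \<open>S x = y\<close>, then \<open>b\<^sub>E = (I - Q\<^sub>E) S a\<^sub>E\<close>, so \<open>\<parallel>b\<^sub>E\<parallel> \<le> \<parallel>S\<parallel> \<parallel>a\<^sub>E\<parallel>\<close>;
  this gives \<open>K \<le> \<parallel>S\<parallel>\<close>, and in particular that \<open>K\<close> is finite (\<open>tail_estimate\<close>).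

  For the converse, replacing \<open>x\<close> by \<open>K x\<close> reduces the construction to a contraction under the
  hypothesis \<open>\<parallel>b\<^sub>E\<parallel> \<le> \<parallel>a\<^sub>E\<parallel>\<close> for all \<open>E\<close>. Both \<open>(P\<^sub>E)\<close> and \<open>(Q\<^sub>E)\<close> are chains of orthogonal
  projections, ordered in the same way (\<open>hm_le_proj_le\<close>), and along a chain the residuals
  satisfy \<open>\<langle>a\<^sub>E, a\<^sub>F\<rangle> = min (\<parallel>a\<^sub>E\<parallel>\<^sup>2) (\<parallel>a\<^sub>F\<parallel>\<^sup>2)\<close>. These are the inner products in \<open>L\<^sup>2(0,\<infinity>)\<close> of
  the indicator functions of the intervals \<open>[0, \<parallel>a\<^sub>E\<parallel>\<^sup>2]\<close>. Hence \<open>a\<^sub>E\<close> can be sent to the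
  indicator of \<open>[0, \<parallel>a\<^sub>E\<parallel>\<^sup>2]\<close> by a partial isometry \<open>W\<^sub>x\<close> from \<open>H\<close> to \<open>L\<^sup>2\<close>, and \<open>b\<^sub>E\<close> to the
  indicator of \<open>[0, \<parallel>b\<^sub>E\<parallel>\<^sup>2]\<close> by a partial isometry \<open>W\<^sub>y\<close>. The operator \<open>T = W\<^sub>y\<^sup>* W\<^sub>x\<close> is a
  contraction. A vector in the range of \<open>P\<^sub>E\<close> is orthogonal to \<open>a\<^sub>F\<close> for all \<open>F \<ge> E\<close>, so \<open>W\<^sub>x\<close>
  sends it to a function that vanishes on \<open>[0, \<parallel>a\<^sub>E\<parallel>\<^sup>2]\<close>. This interval contains
  \<open>[0, \<parallel>b\<^sub>E\<parallel>\<^sup>2]\<close>, where the functions \<open>W\<^sub>y b\<^sub>F\<close> with \<open>F \<ge> E\<close> live. So \<open>T P\<^sub>E u\<close> is orthogonal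
  to these \<open>b\<^sub>F\<close>, whose closed span contains \<open>(I - Q\<^sub>E) T P\<^sub>E u\<close>; therefore
  \<open>(I - Q\<^sub>E) T P\<^sub>E = 0\<close>. Finally \<open>x = a\<^sub>0\<close> and \<open>y = b\<^sub>0\<close>, the longest intervals, and \<open>T x = y\<close>
  because \<open>\<parallel>b\<^sub>0\<parallel> \<le> \<parallel>a\<^sub>0\<parallel>\<close>.

  The space \<open>L\<^sup>2\<close> enters only through its inner products of step functions. The operator \<open>T\<close> is
  characterised by \<open>\<langle>T a\<^sub>E, b\<^sub>F\<rangle> = min (\<parallel>a\<^sub>E\<parallel>\<^sup>2) (\<parallel>b\<^sub>F\<parallel>\<^sup>2)\<close>, by its range lying in the closed
  span of the \<open>b\<^sub>F\<close>, and by its vanishing on the orthogonal complement of the \<open>a\<^sub>E\<close>. It exists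
  (\<open>operator_of_kernel\<close>) because the kernel \<open>min\<close> satisfies a Cauchy-Schwarz inequality
  (\<open>min_kernel_bound\<close>). Uniqueness (\<open>operator_zero_if_matrix_zero\<close>) then yields complex linearity
  and triangularity by evaluation on the residuals (\<open>contractive_interpolation\<close>).
\<close>

section \<open>Riesz representation on subspaces\<close>

text \<open>
  The inequality extends to \<open>s = z\<close> by continuity, where it says \<open>2 \<parallel>z\<parallel>\<^sup>2 \<le> \<parallel>z\<parallel>\<^sup>2 + m\<close>. Bounds
  in this additive form are used throughout in place of Cauchy-Schwarz inequalities: they need
  no normalisation and give the same estimate of the norm.
\<close>
lemma norm_le_of_dense_pairing:
  fixes z :: "'a::real_inner"
  assumes "z \<in> closure S" and "\<And>s. s \<in> S \<Longrightarrow> 2 * (z \<bullet> s) \<le> (norm s)\<^sup>2 + m"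
  shows "(norm z)\<^sup>2 \<le> m"
proof -
  obtain f where f: "\<And>n. f n \<in> S" "f \<longlonglongrightarrow> z"
    using assms(1) unfolding closure_sequential by blast
  have "2 * (z \<bullet> z) \<le> (norm z)\<^sup>2 + m"
  proof (rule LIMSEQ_le)
    show "(\<lambda>n. 2 * (z \<bullet> f n)) \<longlonglongrightarrow> 2 * (z \<bullet> z)"
      by (intro tendsto_intros f)
    show "(\<lambda>n. (norm (f n))\<^sup>2 + m) \<longlonglongrightarrow> (norm z)\<^sup>2 + m"
      by (intro tendsto_intros f)
  qed (use assms(2) f(1) in auto)
  then show ?thesis
    by (simp add: power2_norm_eq_inner)
qed

text \<open>
  The Riesz theorem for a functional that is given only on a subspace, which need not be
  closed, and only through its graph. The bound makes \<open>G\<close> single-valued, so a functional can be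
  prescribed on a spanning set by taking the span of the prescribed pairs, without a choice of
  coefficients. The representing vector is the limit of a minimising sequence of \<open>\<parallel>s\<parallel>\<^sup>2 - 2 r\<close>:
  the parallelogram law makes the sequence Cauchy, and the first variation at the limit
  vanishes.
\<close>
lemma graph_representation:
  fixes G :: "('a::{real_inner,banach} \<times> real) set"
  assumes G: "subspace G" and bound: "\<And>s r. (s, r) \<in> G \<Longrightarrow> 2 * r \<le> (norm s)\<^sup>2 + m"
  obtains z where "z \<in> closure (fst ` G)" "\<And>s r. (s, r) \<in> G \<Longrightarrow> z \<bullet> s = r" "(norm z)\<^sup>2 \<le> m"
proof -
  define J where "J g = (norm (fst g))\<^sup>2 - 2 * snd g" for g :: "'a \<times> real"
  define i where "i = Inf (J ` G)"
  have bdd: "bdd_below (J ` G)"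
    using bound unfolding J_def by (intro bdd_belowI[of _ "- m"]) force
  have le: "i \<le> J g" if "g \<in> G" for g
    unfolding i_def using bdd that by (intro cInf_lower) auto
  have ne: "J ` G \<noteq> {}"
    using subspace_0[OF G] by blast
  have "\<exists>g\<in>G. J g < i + inverse (real (Suc n))" for n
  proof -
    have "Inf (J ` G) < i + inverse (real (Suc n))"
      by (simp add: i_def)
    from cInf_lessD[OF ne this] show ?thesis by auto
  qed
  then obtain g where g: "\<And>n. g n \<in> G" and Jg: "\<And>n. J (g n) < i + inverse (real (Suc n))"
    by metis
  define s where "s n = fst (g n)" for n
  have close: "(norm (s m - s n))\<^sup>2 \<le> 2 * inverse (real (Suc m)) + 2 * inverse (real (Suc n))" for m n
  proof -
    \<comment> \<open>The parallelogram law for the midpoint of two almost minimal points.\<close>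
    have mid: "(1/2) *\<^sub>R (g m + g n) \<in> G"
      by (intro subspace_scale subspace_add G g)
    have "(norm (s m - s n))\<^sup>2 = 2 * J (g m) + 2 * J (g n) - 4 * J ((1/2) *\<^sub>R (g m + g n))"
      unfolding J_def s_def power2_norm_eq_inner
      by (simp add: inner_simps field_simps inner_commute)
    also have "\<dots> \<le> 2 * inverse (real (Suc m)) + 2 * inverse (real (Suc n))"
      using le[OF mid] Jg[of m] Jg[of n] by linarith
    finally show ?thesis .
  qed
  have "Cauchy s"
  proof (rule metric_CauchyI)
    fix e :: real assume "0 < e"
    then obtain M where M: "inverse (real (Suc M)) < e\<^sup>2 / 4"
      using reals_Archimedean[of "e\<^sup>2 / 4"] by auto
    have "dist (s m) (s n) < e" if "m \<ge> M" "n \<ge> M" for m n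
    proof -
      have "inverse (real (Suc m)) \<le> inverse (real (Suc M))"
        "inverse (real (Suc n)) \<le> inverse (real (Suc M))"
        using that by (simp_all add: le_imp_inverse_le)
      then have "(norm (s m - s n))\<^sup>2 < e\<^sup>2"
        using close[of m n] M by linarith
      then show ?thesis
        using \<open>0 < e\<close> by (simp add: dist_norm power2_less_imp_less)
    qed
    then show "\<exists>M. \<forall>m\<ge>M. \<forall>n\<ge>M. dist (s m) (s n) < e" by blast
  qed
  then obtain z where z: "s \<longlonglongrightarrow> z"
    using Cauchy_convergent convergent_def by blast
  have zG: "z \<in> closure (fst ` G)"
    unfolding closure_sequential using g z by (intro exI[of _ s]) (auto simp: s_def)
  have rep: "z \<bullet> h = r" if h: "(h, r) \<in> G" for h r
  proof -
    \<comment> \<open>The functional at the limit does not decrease in the direction of any point of the graph.\<close>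
    have var: "0 \<le> 2 * t * (z \<bullet> h - r) + t\<^sup>2 * (norm h)\<^sup>2" for t :: real
    proof (rule LIMSEQ_le_const)
      have "(\<lambda>n. inverse (real (Suc n)) + 2 * t * (s n \<bullet> h - r) + t\<^sup>2 * (norm h)\<^sup>2)
          \<longlonglongrightarrow> 0 + 2 * t * (z \<bullet> h - r) + t\<^sup>2 * (norm h)\<^sup>2"
        by (intro tendsto_intros z LIMSEQ_inverse_real_of_nat)
      then show "(\<lambda>n. inverse (real (Suc n)) + 2 * t * (s n \<bullet> h - r) + t\<^sup>2 * (norm h)\<^sup>2)
          \<longlonglongrightarrow> 2 * t * (z \<bullet> h - r) + t\<^sup>2 * (norm h)\<^sup>2"
        by simp
      have "0 \<le> inverse (real (Suc n)) + 2 * t * (s n \<bullet> h - r) + t\<^sup>2 * (norm h)\<^sup>2" for n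
      proof -
        have "i \<le> J (g n + t *\<^sub>R (h, r))"
          by (intro le subspace_add subspace_scale G g h)
        also have "\<dots> = J (g n) + 2 * t * (s n \<bullet> h - r) + t\<^sup>2 * (norm h)\<^sup>2"
          unfolding J_def s_def power2_norm_eq_inner
          by (simp add: inner_simps algebra_simps inner_commute power2_eq_square)
        finally show ?thesis using Jg[of n] by linarith
      qed
      then show "\<exists>N. \<forall>n\<ge>N. 0 \<le> inverse (real (Suc n)) + 2 * t * (s n \<bullet> h - r) + t\<^sup>2 * (norm h)\<^sup>2"
        by blast
    qed
    define e N where "e = z \<bullet> h - r" and "N = (norm h)\<^sup>2 + 1"
    have N: "N > 0" by (simp add: N_def add_nonneg_pos)
    \<comment> \<open>The step \<open>t = - e / N\<close> nearly minimises the quadratic; \<open>N\<close> exceeds \<open>\<parallel>h\<parallel>\<^sup>2\<close> so that \<open>h = 0\<close> is covered.\<close>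
    have "0 \<le> (2 * (- e / N) * e + (- e / N)\<^sup>2 * (N - 1)) * N\<^sup>2"
      using var[of "- e / N"] unfolding e_def[symmetric] by (simp add: N_def)
    also have "\<dots> = - (e\<^sup>2 * (N + 1))"
      using N by (simp add: field_simps power2_eq_square)
    finally have "e\<^sup>2 * (N + 1) \<le> 0" by simp
    then have "e = 0"
      using N by (simp add: mult_le_0_iff)
    then show ?thesis by (simp add: e_def)
  qed
  show thesis
  proof (rule that[OF zG rep])
    show "(norm z)\<^sup>2 \<le> m"
      using zG by (rule norm_le_of_dense_pairing) (use rep bound in force)
  qed
qed

lemma inner_zero_on_closed_span:
  fixes z :: "'a::real_inner"
  assumes "v \<in> closure (span B)" and "\<And>b. b \<in> B \<Longrightarrow> z \<bullet> b = 0"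
  shows "z \<bullet> v = 0"
proof -
  have sp: "z \<bullet> s = 0" if "s \<in> span B" for s
    using that by (induction rule: span_induct_alt) (auto simp: inner_simps assms(2))
  have "closed {v. z \<bullet> v = 0}"
    by (intro closed_Collect_eq continuous_intros)
  then have "closure (span B) \<subseteq> {v. z \<bullet> v = 0}"
    using sp by (intro closure_minimal) auto
  with assms(1) show ?thesis by blast
qed

lemma closed_span_zero:
  fixes z :: "'a::real_inner"
  assumes "z \<in> closure (span B)" and "\<And>b. b \<in> B \<Longrightarrow> z \<bullet> b = 0"
  shows "z = 0"
  using inner_zero_on_closed_span[OF assms] by simp

lemma subspace_closed_span: "subspace (closure (span B))"
  for B :: "'a::real_normed_vector set"
proof -
  let ?S = "closure (span B)"
  have add: "u + v \<in> ?S" if "u \<in> ?S" "v \<in> ?S" for u v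
  proof -
    obtain f g where "\<And>n::nat. f n \<in> span B" "f \<longlonglongrightarrow> u" "\<And>n::nat. g n \<in> span B" "g \<longlonglongrightarrow> v"
      using \<open>u \<in> ?S\<close> \<open>v \<in> ?S\<close> unfolding closure_sequential by metis
    then show ?thesis
      unfolding closure_sequential
      by (intro exI[of _ "\<lambda>n. f n + g n"]) (auto intro: span_add tendsto_add)
  qed
  have "c *\<^sub>R u \<in> ?S" if "u \<in> ?S" for c u
  proof -
    obtain f where "\<And>n::nat. f n \<in> span B" "f \<longlonglongrightarrow> u"
      using \<open>u \<in> ?S\<close> unfolding closure_sequential by metis
    then show ?thesis
      unfolding closure_sequential
      by (intro exI[of _ "\<lambda>n. c *\<^sub>R f n"]) (auto intro: span_scale tendsto_scaleR)
  qed
  moreover have "0 \<in> ?S"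
    using span_zero closure_subset by blast
  ultimately show ?thesis
    using add by (auto simp: subspace_def)
qed

text \<open>
  The projection theorem for a closed span: \<open>v\<close> represents the functional \<open>s \<mapsto> \<langle>u, s\<rangle>\<close> on the
  span.
\<close>
lemma closed_span_decomposition:
  fixes u :: "'a::{real_inner,banach}"
  obtains v where "v \<in> closure (span A)" "\<And>a. a \<in> A \<Longrightarrow> (u - v) \<bullet> a = 0"
proof -
  define G where "G = (\<lambda>s. (s, u \<bullet> s)) ` span A"
  have "linear (\<lambda>s. (s, u \<bullet> s))"
    by (intro linearI) (auto simp: inner_simps)
  then have "subspace G"
    unfolding G_def by (rule linear_subspace_image) (rule subspace_span)
  moreover have "2 * r \<le> (norm s)\<^sup>2 + (norm u)\<^sup>2" if "(s, r) \<in> G" for s r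
  proof -
    have "0 \<le> (norm (s - u))\<^sup>2" by simp
    then show ?thesis
      using that unfolding G_def power2_norm_eq_inner
      by (auto simp: inner_simps inner_commute)
  qed
  ultimately obtain z where z: "z \<in> closure (fst ` G)" "\<And>s r. (s, r) \<in> G \<Longrightarrow> z \<bullet> s = r"
    using graph_representation[of G "(norm u)\<^sup>2"] by metis
  have "fst ` G = span A"
    by (auto simp: G_def image_iff)
  show thesis
  proof (rule that[of z])
    show "z \<in> closure (span A)" using z(1) \<open>fst ` G = span A\<close> by simp
    show "(u - z) \<bullet> a = 0" if "a \<in> A" for a
      using z(2)[of a "u \<bullet> a"] span_base[OF that] by (auto simp: G_def inner_simps)
  qed
qed

section \<open>Operators with prescribed matrix entries\<close>

text \<open>
  The uniqueness half of the construction. A vector of the closed span of \<open>B\<close> that is orthogonal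
  to \<open>B\<close> is zero, so \<open>D\<close> vanishes on the closed span of \<open>A\<close> as well as on its orthogonal
  complement. Identities between operators are proved below by taking \<open>D\<close> to be the difference
  of the two sides.
\<close>
lemma operator_zero_if_matrix_zero:
  fixes D :: "'a::{real_inner,banach} \<Rightarrow> 'a"
  assumes D: "bounded_linear D"
    and perp: "\<And>u. (\<And>a. a \<in> A \<Longrightarrow> u \<bullet> a = 0) \<Longrightarrow> D u = 0"
    and range: "\<And>a. a \<in> A \<Longrightarrow> D a \<in> closure (span B)"
    and zero: "\<And>a b. a \<in> A \<Longrightarrow> b \<in> B \<Longrightarrow> D a \<bullet> b = 0"
  shows "D u = 0"
proof -
  interpret D: bounded_linear D by fact
  obtain v where v: "v \<in> closure (span A)" "\<And>a. a \<in> A \<Longrightarrow> (u - v) \<bullet> a = 0"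
    using closed_span_decomposition[of A u] by blast
  have "D a = 0" if "a \<in> A" for a
    using range[OF that] zero[OF that] by (rule closed_span_zero)
  then have "span A \<subseteq> {v. D v = 0}"
    by (intro span_minimal) (auto simp: subspace_def D.add D.scaleR D.zero)
  moreover have "closed {v. D v = 0}"
    by (intro closed_Collect_eq D.continuous_on continuous_intros)
  ultimately have "D v = 0"
    using v(1) closure_minimal by blast
  moreover have "D (u - v) = 0"
    using v(2) by (rule perp)
  ultimately show ?thesis
    by (simp add: D.diff)
qed

text \<open>
  Coefficients are attached to indices rather than to vectors, because the matrix entries
  paired with them below are functions of the indices, and different indices may carry the same
  vector.
\<close>
lemma span_image_explicit:
  fixes g :: "'i \<Rightarrow> 'a::real_vector"
  assumes "v \<in> span (g ` I)"
  obtains A r where "finite A" "A \<subseteq> I" "v = (\<Sum>i\<in>A. r i *\<^sub>R g i)"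
proof -
  obtain t q where t: "finite t" "t \<subseteq> g ` I" "v = (\<Sum>w\<in>t. q w *\<^sub>R w)"
    using assms unfolding span_explicit by blast
  obtain A where A: "A \<subseteq> I" "inj_on g A" "t = g ` A"
    using subset_image_inj t(2) by metis
  show thesis
  proof (rule that[of A "\<lambda>i. q (g i)"])
    show "finite A" using t(1) A by (simp add: finite_image_iff)
    show "v = (\<Sum>i\<in>A. q (g i) *\<^sub>R g i)"
      using A t(3) by (simp add: sum.reindex)
  qed (rule A)
qed

text \<open>
  The existence half. The bound is the Cauchy-Schwarz inequality for the form with matrix \<open>k\<close>,
  in additive form. A first use of the Riesz theorem turns column \<open>j\<close> into a vector \<open>w\<^sub>j\<close>,
  which will be \<open>T\<^sup>* b\<^sub>j\<close>; the bound shows that \<open>b\<^sub>j \<mapsto> w\<^sub>j\<close> contracts norms of linear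
  combinations. A second use, for the functional \<open>b\<^sub>j \<mapsto> \<langle>u, w\<^sub>j\<rangle>\<close>, produces \<open>T u\<close>. Linearity of
  \<open>T\<close> comes from the uniqueness of representing vectors in the closed span.
\<close>
lemma operator_of_kernel:
  fixes a :: "'i \<Rightarrow> 'a::{real_inner,banach}" and b :: "'j \<Rightarrow> 'a"
  assumes bound: "\<And>A B r s. finite A \<Longrightarrow> A \<subseteq> I \<Longrightarrow> finite B \<Longrightarrow> B \<subseteq> J \<Longrightarrow>
    2 * (\<Sum>i\<in>A. \<Sum>j\<in>B. r i * s j * k i j)
      \<le> (norm (\<Sum>i\<in>A. r i *\<^sub>R a i))\<^sup>2 + (norm (\<Sum>j\<in>B. s j *\<^sub>R b j))\<^sup>2"
  obtains T where "bounded_linear T" "\<And>u. norm (T u) \<le> norm u"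
    "\<And>i j. i \<in> I \<Longrightarrow> j \<in> J \<Longrightarrow> T (a i) \<bullet> b j = k i j"
    "\<And>u. T u \<in> closure (span (b ` J))"
    "\<And>u. (\<And>i. i \<in> I \<Longrightarrow> u \<bullet> a i = 0) \<Longrightarrow> T u = 0"
proof -
  have "\<exists>w. w \<in> closure (span (a ` I)) \<and> (\<forall>i\<in>I. w \<bullet> a i = k i j)" if j: "j \<in> J" for j
  proof -
    define G where "G = span ((\<lambda>i. (a i, k i j)) ` I)"
    have subspace_G: "subspace G" unfolding G_def by (rule subspace_span)
    have "2 * r \<le> (norm s)\<^sup>2 + (norm (b j))\<^sup>2" if "(s, r) \<in> G" for s r
    proof -
      obtain A q where A: "finite A" "A \<subseteq> I" "(s, r) = (\<Sum>i\<in>A. q i *\<^sub>R (a i, k i j))"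
        using \<open>(s, r) \<in> G\<close> unfolding G_def by (rule span_image_explicit)
      have "s = (\<Sum>i\<in>A. q i *\<^sub>R a i)" "r = (\<Sum>i\<in>A. q i * k i j)"
        using arg_cong[OF A(3), of fst] arg_cong[OF A(3), of snd] by (simp_all add: fst_sum snd_sum)
      then show ?thesis
        using bound[of A "{j}" q "\<lambda>_. 1"] A j by simp
    qed
    then obtain z where z: "z \<in> closure (fst ` G)" "\<And>s r. (s, r) \<in> G \<Longrightarrow> z \<bullet> s = r"
      using graph_representation[OF subspace_G, of "(norm (b j))\<^sup>2"] by blast
    have "fst ` G = span (a ` I)"
      unfolding G_def by (simp add: linear_span_image[OF linear_fst, symmetric] image_image)
    then show ?thesis
    proof (intro exI[of _ z] conjI ballI)
      show "z \<in> closure (span (a ` I))" using z(1) \<open>fst ` G = span (a ` I)\<close> by simp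
      show "z \<bullet> a i = k i j" if "i \<in> I" for i
        using that by (intro z(2)) (auto simp: G_def intro: span_base)
    qed
  qed
  then obtain w where w: "\<And>j. j \<in> J \<Longrightarrow> w j \<in> closure (span (a ` I))"
    and wk: "\<And>i j. j \<in> J \<Longrightarrow> i \<in> I \<Longrightarrow> w j \<bullet> a i = k i j"
    by metis
  have wb: "(norm (\<Sum>j\<in>B. s j *\<^sub>R w j))\<^sup>2 \<le> (norm (\<Sum>j\<in>B. s j *\<^sub>R b j))\<^sup>2"
    if B: "finite B" "B \<subseteq> J" for B s
  proof (rule norm_le_of_dense_pairing)
    show "(\<Sum>j\<in>B. s j *\<^sub>R w j) \<in> closure (span (a ` I))"
      using B w by (intro subspace_sum subspace_scale subspace_closed_span) auto
    fix v assume "v \<in> span (a ` I)"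
    then obtain A r where A: "finite A" "A \<subseteq> I" "v = (\<Sum>i\<in>A. r i *\<^sub>R a i)"
      by (rule span_image_explicit)
    have "(\<Sum>j\<in>B. s j *\<^sub>R w j) \<bullet> v = (\<Sum>i\<in>A. \<Sum>j\<in>B. r i * s j * k i j)"
      unfolding A(3) inner_sum_left inner_sum_right using wk A(2) B(2)
      by (auto intro!: sum.cong simp: subset_iff)
    then show "2 * ((\<Sum>j\<in>B. s j *\<^sub>R w j) \<bullet> v) \<le> (norm v)\<^sup>2 + (norm (\<Sum>j\<in>B. s j *\<^sub>R b j))\<^sup>2"
      using bound[OF A(1,2) B, of r s] A(3) by simp
  qed
  have "\<exists>z. z \<in> closure (span (b ` J)) \<and> (\<forall>j\<in>J. z \<bullet> b j = u \<bullet> w j) \<and> (norm z)\<^sup>2 \<le> (norm u)\<^sup>2" for u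
  proof -
    define G where "G = span ((\<lambda>j. (b j, u \<bullet> w j)) ` J)"
    have subspace_G: "subspace G" unfolding G_def by (rule subspace_span)
    have "2 * r \<le> (norm s)\<^sup>2 + (norm u)\<^sup>2" if "(s, r) \<in> G" for s r
    proof -
      obtain B q where B: "finite B" "B \<subseteq> J" "(s, r) = (\<Sum>j\<in>B. q j *\<^sub>R (b j, u \<bullet> w j))"
        using \<open>(s, r) \<in> G\<close> unfolding G_def by (rule span_image_explicit)
      define v where "v = (\<Sum>j\<in>B. q j *\<^sub>R w j)"
      have s: "s = (\<Sum>j\<in>B. q j *\<^sub>R b j)" and r: "r = u \<bullet> v"
        using arg_cong[OF B(3), of fst] arg_cong[OF B(3), of snd]
        by (simp_all add: fst_sum snd_sum v_def inner_sum_right)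
      have "0 \<le> (norm (u - v))\<^sup>2" by simp
      then have "2 * r \<le> (norm v)\<^sup>2 + (norm u)\<^sup>2"
        unfolding r power2_norm_eq_inner by (simp add: inner_simps inner_commute)
      also have "(norm v)\<^sup>2 \<le> (norm s)\<^sup>2"
        unfolding v_def s using B(1,2) by (rule wb)
      finally show ?thesis by simp
    qed
    then obtain z where z: "z \<in> closure (fst ` G)" "\<And>s r. (s, r) \<in> G \<Longrightarrow> z \<bullet> s = r"
      "(norm z)\<^sup>2 \<le> (norm u)\<^sup>2"
      using graph_representation[OF subspace_G, of "(norm u)\<^sup>2"] by blast
    have "fst ` G = span (b ` J)"
      unfolding G_def by (simp add: linear_span_image[OF linear_fst, symmetric] image_image)
    then show ?thesis
    proof (intro exI[of _ z] conjI ballI)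
      show "z \<in> closure (span (b ` J))" using z(1) \<open>fst ` G = span (b ` J)\<close> by simp
      show "z \<bullet> b j = u \<bullet> w j" if "j \<in> J" for j
        using that by (intro z(2)) (auto simp: G_def intro: span_base)
    qed (rule z)
  qed
  then obtain T where T: "\<And>u. T u \<in> closure (span (b ` J))"
    and Tb: "\<And>u j. j \<in> J \<Longrightarrow> T u \<bullet> b j = u \<bullet> w j"
    and "\<And>u. (norm (T u))\<^sup>2 \<le> (norm u)\<^sup>2"
    by metis
  then have Tn: "\<And>u. norm (T u) \<le> norm u"
    by (simp add: power2_le_iff_abs_le)
  have add: "T (u + v) - (T u + T v) = 0" for u v
    by (rule closed_span_zero[of _ "b ` J"])
      (auto intro!: subspace_diff subspace_add subspace_closed_span T simp: inner_simps Tb)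
  have scale: "T (c *\<^sub>R u) - c *\<^sub>R T u = 0" for u c
    by (rule closed_span_zero[of _ "b ` J"])
      (auto intro!: subspace_diff subspace_scale subspace_closed_span T simp: inner_simps Tb)
  show thesis
  proof (rule that[OF _ Tn _ T])
    show "bounded_linear T"
      using add scale Tn by (intro bounded_linear_intro[where K = 1]) auto
    show "T (a i) \<bullet> b j = k i j" if "i \<in> I" "j \<in> J" for i j
      using that by (simp add: Tb wk inner_commute[of "a i"])
    show "T u = 0" if "\<And>i. i \<in> I \<Longrightarrow> u \<bullet> a i = 0" for u
    proof (rule closed_span_zero[OF T])
      fix c assume "c \<in> b ` J"
      then obtain j where j: "j \<in> J" "c = b j" by blast
      have "u \<bullet> w j = 0"
        using w[OF j(1)] by (rule inner_zero_on_closed_span) (use that in auto)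
      then show "T u \<bullet> c = 0" using j by (simp add: Tb)
    qed
  qed
qed

section \<open>The kernel min\<close>

definition step :: "real \<Rightarrow> real \<Rightarrow> real"
  where "step r = indicator {0..r}"

lemma step_pairing:
  fixes c :: "'i \<Rightarrow> complex" and d :: "'j \<Rightarrow> complex"
  assumes "\<And>i. i \<in> A \<Longrightarrow> 0 \<le> p i" "\<And>j. j \<in> B \<Longrightarrow> 0 \<le> q j"
  shows "has_bochner_integral lborel
      (\<lambda>t. (\<Sum>i\<in>A. step (p i) t *\<^sub>R c i) \<bullet> (\<Sum>j\<in>B. step (q j) t *\<^sub>R d j))
      (\<Sum>i\<in>A. \<Sum>j\<in>B. (c i \<bullet> d j) * min (p i) (q j))"
proof -
  have step: "has_bochner_integral lborel (\<lambda>t. step r t * step s t) (min r s)"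
    if "0 \<le> r" "0 \<le> s" for r s
  proof -
    have "has_bochner_integral lborel (indicator {0..min r s} :: real \<Rightarrow> real) (measure lborel {0..min r s})"
      by (rule has_bochner_integral_real_indicator) (auto simp del: min_def simp: emeasure_lborel_Icc_eq)
    moreover have "(\<lambda>t. step r t * step s t) = indicator {0..min r s}"
      by (auto simp: step_def fun_eq_iff indicator_def)
    ultimately show ?thesis using that by simp
  qed
  have "has_bochner_integral lborel
      (\<lambda>t. \<Sum>i\<in>A. \<Sum>j\<in>B. (c i \<bullet> d j) * (step (p i) t * step (q j) t))
      (\<Sum>i\<in>A. \<Sum>j\<in>B. (c i \<bullet> d j) * min (p i) (q j))"
    using assms by (intro has_bochner_integral_sum has_bochner_integral_mult_right step) auto
  moreover have "(\<Sum>i\<in>A. step (p i) t *\<^sub>R c i) \<bullet> (\<Sum>j\<in>B. step (q j) t *\<^sub>R d j)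
      = (\<Sum>i\<in>A. \<Sum>j\<in>B. (c i \<bullet> d j) * (step (p i) t * step (q j) t))" for t
    by (simp add: inner_sum_left inner_sum_right mult_ac sum_distrib_left) (rule sum.swap)
  ultimately show ?thesis by simp
qed

text \<open>
  The pointwise inequality \<open>2 \<langle>f, g\<rangle> \<le> \<parallel>f\<parallel>\<^sup>2 + \<parallel>g\<parallel>\<^sup>2\<close>, integrated over step functions:
  \<open>min r s\<close> is the inner product of the indicators of \<open>[0, r]\<close> and \<open>[0, s]\<close>.
\<close>
lemma min_kernel_bound:
  fixes c :: "'i \<Rightarrow> complex" and d :: "'j \<Rightarrow> complex"
  assumes p: "\<And>i. i \<in> A \<Longrightarrow> 0 \<le> p i" and q: "\<And>j. j \<in> B \<Longrightarrow> 0 \<le> q j"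
  shows "2 * (\<Sum>i\<in>A. \<Sum>j\<in>B. (c i \<bullet> d j) * min (p i) (q j))
    \<le> (\<Sum>i\<in>A. \<Sum>j\<in>A. (c i \<bullet> c j) * min (p i) (p j))
      + (\<Sum>i\<in>B. \<Sum>j\<in>B. (d i \<bullet> d j) * min (q i) (q j))"
    (is "?l \<le> ?r")
proof -
  define f where "f t = (\<Sum>i\<in>A. step (p i) t *\<^sub>R c i)" for t
  define g where "g t = (\<Sum>j\<in>B. step (q j) t *\<^sub>R d j)" for t
  have fg: "has_bochner_integral lborel (\<lambda>t. 2 * (f t \<bullet> g t)) ?l"
    unfolding f_def g_def by (intro has_bochner_integral_mult_right step_pairing p q)
  have ff: "has_bochner_integral lborel (\<lambda>t. f t \<bullet> f t + g t \<bullet> g t) ?r"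
    unfolding f_def g_def by (intro has_bochner_integral_add step_pairing p q)
  have "2 * (f t \<bullet> g t) \<le> f t \<bullet> f t + g t \<bullet> g t" for t
    using inner_ge_zero[of "f t - g t"] by (simp add: inner_diff_left inner_diff_right inner_commute)
  with fg ff show ?thesis
    using integral_mono[of lborel "\<lambda>t. 2 * (f t \<bullet> g t)" "\<lambda>t. f t \<bullet> f t + g t \<bullet> g t"]
    by (simp add: has_bochner_integral_iff)
qed

section \<open>Complex inner products and adjoints\<close>

lemma scaleC_one: "1 *\<^sub>C v = v"
  using scaleC_of_real[of 1 v] by simp

lemma scaleC_zero_right: "c *\<^sub>C 0 = (0::'a::complex_hilbert_space)"
  using scaleC_add_right[of c 0 0] by simp

lemma scaleC_diff_right: "c *\<^sub>C (u - v) = c *\<^sub>C u - c *\<^sub>C v"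
  using scaleC_add_right[of c "u - v" v] by simp

lemma scaleC_scaleR_commute: "c *\<^sub>C (r *\<^sub>R v) = r *\<^sub>R (c *\<^sub>C v)"
  by (simp add: scaleC_of_real[symmetric] scaleC_scaleC mult.commute)

lemma cinner_scaleC_right: "cinner u (c *\<^sub>C v) = cnj c * cinner u v"
  using cinner_commute[of u "c *\<^sub>C v"] cinner_commute[of v u] by (simp add: cinner_scaleC_left)

lemma cinner_add_right: "cinner u (v + w) = cinner u v + cinner u w"
  using cinner_commute[of u "v + w"] cinner_commute[of v u] cinner_commute[of w u]
  by (simp add: cinner_add_left)

lemma cinner_diff_left: "cinner (u - v) w = cinner u w - cinner v w"
  using cinner_add_left[of "u - v" v w] by simp

lemma cinner_zero_left: "cinner 0 v = 0"
  using cinner_add_left[of 0 0 v] by simp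

lemma cinner_zero_right: "cinner v 0 = 0"
  using cinner_add_right[of v 0 0] by simp

lemma cinner_self: "cinner v v = complex_of_real ((norm v)\<^sup>2)"
proof (rule complex_eqI)
  show "Re (cinner v v) = Re (complex_of_real ((norm v)\<^sup>2))"
    by (simp add: inner_eq_Re_cinner[symmetric] power2_norm_eq_inner)
  have "Im (cinner v v) = Im (cnj (cinner v v))"
    using cinner_commute[of v v] by simp
  then show "Im (cinner v v) = Im (complex_of_real ((norm v)\<^sup>2))" by simp
qed

lemma inner_scaleC_left: "(c *\<^sub>C u) \<bullet> v = u \<bullet> (cnj c *\<^sub>C v)"
  by (simp add: inner_eq_Re_cinner cinner_scaleC_left cinner_scaleC_right)

lemma inner_scaleC_of_real_cinner:
  assumes "cinner u v = complex_of_real r"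
  shows "(c *\<^sub>C u) \<bullet> (d *\<^sub>C v) = (c \<bullet> d) * r"
  by (simp add: inner_eq_Re_cinner[of "c *\<^sub>C u"] cinner_scaleC_left cinner_scaleC_right assms
      inner_complex_def algebra_simps)

text \<open>
  The imaginary part of \<open>\<langle>u, v\<rangle>\<close> is minus the real part of \<open>\<langle>i u, v\<rangle>\<close>; this transfers
  identities from the real inner product, for which the Riesz theorem is stated, to the complex
  one.
\<close>
lemma cinner_eqI_inner:
  assumes "\<And>c. (c *\<^sub>C u) \<bullet> v = (c *\<^sub>C u') \<bullet> v'"
  shows "cinner u v = cinner u' v'"
  using assms[of 1] assms[of \<i>]
  by (simp add: inner_eq_Re_cinner cinner_scaleC_left complex_eq_iff)

lemma norm_scaleC: "norm (c *\<^sub>C v) = norm c * norm v"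
proof -
  have "(norm (c *\<^sub>C v))\<^sup>2 = (norm c * norm v)\<^sup>2"
    using inner_scaleC_of_real_cinner[OF cinner_self, of c v c]
    by (simp add: power2_norm_eq_inner[symmetric] power_mult_distrib)
  then show ?thesis
    by (simp add: power2_eq_iff_nonneg)
qed

lemma bounded_linear_scaleC_right: "bounded_linear (\<lambda>v. c *\<^sub>C v)"
  by (rule bounded_linear_intro[where K = "norm c"])
    (simp_all add: scaleC_add_right scaleC_scaleR_commute norm_scaleC mult.commute)

lemma bounded_operatorsD:
  assumes "T \<in> bounded_operators"
  shows "bounded_linear T" "T (c *\<^sub>C v) = c *\<^sub>C T v"
  using assms by (auto simp: bounded_operators_def)

text \<open>
  Since \<^const>\<open>cadjoint\<close> is a definite description, its defining identity requires that an adjoint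
  exists; the Riesz theorem supplies one.
\<close>
lemma cadjoint:
  fixes T :: "'a::complex_hilbert_space \<Rightarrow> 'a"
  assumes T: "T \<in> bounded_operators"
  shows "cinner (T v) w = cinner v (cadjoint T w)"
proof -
  interpret T: bounded_linear T using T by (rule bounded_operatorsD)
  have "\<exists>z. \<forall>v. z \<bullet> v = T v \<bullet> w" for w
  proof -
    define G where "G = range (\<lambda>v. (v, T v \<bullet> w))"
    have "linear (\<lambda>v. (v, T v \<bullet> w))"
      by (intro linearI) (auto simp: T.add T.scaleR inner_add_left)
    then have "subspace G"
      unfolding G_def by (rule linear_subspace_image) (rule subspace_UNIV)
    moreover have "2 * r \<le> (norm v)\<^sup>2 + (onorm T * norm w)\<^sup>2" if "(v, r) \<in> G" for v r
    proof -
      have "r = T v \<bullet> w" using that by (auto simp: G_def)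
      also have "\<dots> \<le> norm (T v) * norm w" by (rule norm_cauchy_schwarz)
      also have "\<dots> \<le> norm v * (onorm T * norm w)"
        using onorm[OF T.bounded_linear_axioms, of v] mult_right_mono[OF _ norm_ge_zero[of w]]
        by (force simp: mult_ac)
      finally show ?thesis
        using sum_squares_bound[of "norm v" "onorm T * norm w"] by simp
    qed
    ultimately obtain z where "\<And>v r. (v, r) \<in> G \<Longrightarrow> z \<bullet> v = r"
      using graph_representation[of G "(onorm T * norm w)\<^sup>2"] by blast
    then show ?thesis by (intro exI[of _ z]) (auto simp: G_def)
  qed
  then obtain W where W: "\<And>v w. W w \<bullet> v = T v \<bullet> w" by metis
  have "cinner (T v) w = cinner v (W w)" for v w
  proof (rule cinner_eqI_inner)
    fix c
    show "(c *\<^sub>C T v) \<bullet> w = (c *\<^sub>C v) \<bullet> W w"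
      using W[of w "c *\<^sub>C v"] by (simp add: bounded_operatorsD(2)[OF T] inner_commute[of _ "W w"])
  qed
  then show ?thesis
    using cadjoint_eqI[of T W] by simp
qed

section \<open>Chains of orthogonal projections\<close>

definition orthogonal_projection :: "('a::complex_hilbert_space \<Rightarrow> 'a) \<Rightarrow> bool"
  where "orthogonal_projection P \<longleftrightarrow> P \<in> bounded_operators \<and> (\<forall>v. P (P v) = P v) \<and>
    (\<forall>v w. cinner (P v) w = cinner v (P w))"

definition proj_le :: "('a \<Rightarrow> 'a) \<Rightarrow> ('a \<Rightarrow> 'a) \<Rightarrow> bool"
  where "proj_le P R \<longleftrightarrow> (\<forall>v. R (P v) = P v)"

context
  fixes P :: "'a::complex_hilbert_space \<Rightarrow> 'a"
  assumes P: "orthogonal_projection P"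
begin

lemma proj_bounded_operator: "P \<in> bounded_operators"
  using P by (simp add: orthogonal_projection_def)

lemma proj_bounded_linear: "bounded_linear P"
  by (rule bounded_operatorsD[OF proj_bounded_operator])

lemma proj_diff: "P (u - v) = P u - P v"
  by (intro linear_diff bounded_linear.linear proj_bounded_linear)

lemma proj_0: "P 0 = 0"
  by (intro linear_0 bounded_linear.linear proj_bounded_linear)

lemma proj_scaleR: "P (r *\<^sub>R v) = r *\<^sub>R P v"
  by (intro linear_scale bounded_linear.linear proj_bounded_linear)

lemma proj_scaleC: "P (c *\<^sub>C v) = c *\<^sub>C P v"
  by (rule bounded_operatorsD[OF proj_bounded_operator])

lemma proj_idem: "P (P v) = P v"
  using P by (simp add: orthogonal_projection_def)

lemma proj_cinner: "cinner (P u) v = cinner u (P v)"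
  using P unfolding orthogonal_projection_def by blast

lemma proj_inner: "P u \<bullet> v = u \<bullet> P v"
  by (simp only: inner_eq_Re_cinner proj_cinner)

lemma proj_pythagoras: "(norm v)\<^sup>2 = (norm (P v))\<^sup>2 + (norm (v - P v))\<^sup>2"
proof -
  have "P v \<bullet> v = P v \<bullet> P v"
    using proj_inner[of "P v" v] by (simp add: proj_idem)
  then show ?thesis
    by (simp add: power2_norm_eq_inner inner_diff_left inner_diff_right inner_commute)
qed

lemma norm_residual_le: "norm (v - P v) \<le> norm v"
  using proj_pythagoras[of v] by (simp add: power2_le_imp_le)

lemma proj_fixed_if_norm_eq: "norm (P v) = norm v \<Longrightarrow> P v = v"
  using proj_pythagoras[of v] by simp

end

text \<open>
  Taking adjoints turns \<open>R P = P\<close> into \<open>P R = P\<close>.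
\<close>
lemma proj_le_swap:
  assumes P: "orthogonal_projection P" and R: "orthogonal_projection R" and le: "proj_le P R"
  shows "P (R v) = P v"
proof (rule cinner_ext)
  fix u
  have "cinner u (P (R v)) = cinner (R (P u)) v"
    by (simp add: proj_cinner[OF P] proj_cinner[OF R])
  also have "\<dots> = cinner u (P v)"
    using le by (simp add: proj_le_def proj_cinner[OF P])
  finally show "cinner u (P (R v)) = cinner u (P v)" .
qed

text \<open>
  For \<open>P \<le> R\<close> the residual of \<open>R\<close> is the image of the residual of \<open>P\<close> under the projection
  \<open>I - R\<close>; hence the inner product of the two residuals is the squared norm of the smaller one.
\<close>
lemma residual_chain:
  assumes P: "orthogonal_projection P" and R: "orthogonal_projection R" and le: "proj_le P R"
  shows "P (x - R x) = 0" "R (x - P x) = (x - P x) - (x - R x)"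
    "cinner (x - P x) (x - R x) = complex_of_real ((norm (x - R x))\<^sup>2)"
    "cinner (x - R x) (x - P x) = complex_of_real ((norm (x - R x))\<^sup>2)"
    "norm (x - R x) \<le> norm (x - P x)"
proof -
  show "P (x - R x) = 0"
    by (simp add: proj_diff[OF P] proj_le_swap[OF assms])
  show R_res: "R (x - P x) = (x - P x) - (x - R x)"
    using le by (simp add: proj_diff[OF R] proj_le_def)
  have "R (x - R x) = 0"
    by (simp add: proj_diff[OF R] proj_idem[OF R])
  then have "cinner (R (x - P x)) (x - R x) = 0"
    by (simp add: proj_cinner[OF R, of "x - P x"] cinner_zero_right)
  then show c: "cinner (x - P x) (x - R x) = complex_of_real ((norm (x - R x))\<^sup>2)"
    unfolding R_res by (simp only: cinner_diff_left[of "x - P x"] cinner_self) simp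
  show "cinner (x - R x) (x - P x) = complex_of_real ((norm (x - R x))\<^sup>2)"
    using c cinner_commute[of "x - R x" "x - P x"] by simp
  have "x - R x = (x - P x) - R (x - P x)"
    unfolding R_res by simp
  then show "norm (x - R x) \<le> norm (x - P x)"
    using norm_residual_le[OF R, of "x - P x"] by metis
qed

section \<open>Contractive interpolation along two chains\<close>

lemma closed_span_invariant:
  assumes f: "bounded_linear f" and B: "\<And>b. b \<in> B \<Longrightarrow> f b \<in> span B" and v: "v \<in> closure (span B)"
  shows "f v \<in> closure (span B)"
proof -
  interpret f: bounded_linear f by fact
  have "span (f ` B) \<subseteq> span B"
    using B by (intro span_minimal subspace_span) auto
  then have "f ` span B \<subseteq> span B"
    by (simp add: linear_span_image[OF f.linear])
  then show ?thesis
    using closure_bounded_linear_image_subset[OF f, of "span B"] closure_mono v by blast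
qed

text \<open>
  The operator is the one with \<open>\<langle>T a\<^sub>E, b\<^sub>F\<rangle> = min (\<parallel>a\<^sub>E\<parallel>\<^sup>2) (\<parallel>b\<^sub>F\<parallel>\<^sup>2)\<close>, where \<open>a\<close> and \<open>b\<close> are
  the residuals of \<open>x\<close> and \<open>y\<close>. Triangularity reduces to the following remark: for \<open>G \<le> E\<close> the
  projection \<open>P\<^sub>E\<close> sends \<open>a\<^sub>G\<close> to \<open>a\<^sub>G - a\<^sub>E\<close>, and for \<open>F \<ge> E\<close> the numbers
  \<open>min (\<parallel>a\<^sub>G\<parallel>\<^sup>2) (\<parallel>b\<^sub>F\<parallel>\<^sup>2)\<close> and \<open>min (\<parallel>a\<^sub>E\<parallel>\<^sup>2) (\<parallel>b\<^sub>F\<parallel>\<^sup>2)\<close> are both \<open>\<parallel>b\<^sub>F\<parallel>\<^sup>2\<close>.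
\<close>
lemma contractive_interpolation:
  fixes P Q :: "'e \<Rightarrow> 'a::complex_hilbert_space \<Rightarrow> 'a" and x y :: 'a
  assumes P: "\<And>E. E \<in> N \<Longrightarrow> orthogonal_projection (P E)"
    and Q: "\<And>E. E \<in> N \<Longrightarrow> orthogonal_projection (Q E)"
    and chain: "\<And>E F. E \<in> N \<Longrightarrow> F \<in> N \<Longrightarrow>
      proj_le (P E) (P F) \<and> proj_le (Q E) (Q F) \<or> proj_le (P F) (P E) \<and> proj_le (Q F) (Q E)"
    and bot: "e \<in> N" "\<And>v. P e v = 0" "\<And>v. Q e v = 0"
    and tails: "\<And>E. E \<in> N \<Longrightarrow> norm (y - Q E y) \<le> norm (x - P E x)"
  obtains T where "T \<in> bounded_operators" "\<And>u. norm (T u) \<le> norm u" "T x = y"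
    "\<And>E v. E \<in> N \<Longrightarrow> T (P E v) - Q E (T (P E v)) = 0"
proof -
  define le where "le E F \<longleftrightarrow> proj_le (P E) (P F) \<and> proj_le (Q E) (Q F)" for E F
  have total: "le E F \<or> le F E" if "E \<in> N" "F \<in> N" for E F
    using chain[OF that] by (auto simp: le_def)
  define a where "a E = x - P E x" for E
  define b where "b E = y - Q E y" for E
  define p where "p E = (norm (a E))\<^sup>2" for E
  define q where "q E = (norm (b E))\<^sup>2" for E
  have a: "P E (a F) = 0" "P F (a E) = a E - a F" "p F \<le> p E"
    "cinner (a E) (a F) = p F" "cinner (a F) (a E) = p F" if "E \<in> N" "F \<in> N" "le E F" for E F
    using residual_chain[OF P P, of E F x] that by (auto simp: le_def a_def p_def)
  have b: "Q E (b F) = 0" "Q F (b E) = b E - b F" "q F \<le> q E"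
    "cinner (b E) (b F) = q F" "cinner (b F) (b E) = q F" if "E \<in> N" "F \<in> N" "le E F" for E F
    using residual_chain[OF Q Q, of E F y] that by (auto simp: le_def b_def q_def)
  have qp: "q E \<le> p E" if "E \<in> N" for E
    using tails[OF that] by (simp add: p_def q_def a_def b_def power_mono)
  have bot_le: "le e E" if "E \<in> N" for E
    using that bot(1) by (auto simp: le_def proj_le_def bot proj_0 P Q)
  have a_bot: "a e = x" and b_bot: "b e = y"
    by (simp_all add: a_def b_def bot)
  have gram_a: "cinner (a E) (a F) = min (p E) (p F)" if "E \<in> N" "F \<in> N" for E F
    using total[OF that] a[of E F] a[of F E] that by (auto simp: min_def)
  have gram_b: "cinner (b E) (b F) = min (q E) (q F)" if "E \<in> N" "F \<in> N" for E F
    using total[OF that] b[of E F] b[of F E] that by (auto simp: min_def)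
  \<comment> \<open>Real spans of the families \<open>ca\<close> and \<open>cb\<close> below are complex spans of the residuals, so the index carries a complex factor.\<close>
  define I where "I = (UNIV :: complex set) \<times> N"
  define ca where "ca i = fst i *\<^sub>C a (snd i)" for i
  define cb where "cb i = fst i *\<^sub>C b (snd i)" for i
  define k where "k i j = (fst i \<bullet> fst j) * min (p (snd i)) (q (snd j))" for i j :: "complex \<times> 'e"
  have ca_mem: "c *\<^sub>C a E \<in> ca ` I" and cb_mem: "c *\<^sub>C b E \<in> cb ` I" if "E \<in> N" for c E
    using that by (force simp: ca_def cb_def I_def)+
  have gram_ca: "ca i \<bullet> ca j = (fst i \<bullet> fst j) * min (p (snd i)) (p (snd j))" if "i \<in> I" "j \<in> I" for i j
    unfolding ca_def by (rule inner_scaleC_of_real_cinner, rule gram_a) (use that in \<open>auto simp: I_def\<close>)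
  have gram_cb: "cb i \<bullet> cb j = (fst i \<bullet> fst j) * min (q (snd i)) (q (snd j))" if "i \<in> I" "j \<in> I" for i j
    unfolding cb_def by (rule inner_scaleC_of_real_cinner, rule gram_b) (use that in \<open>auto simp: I_def\<close>)
  have bound: "2 * (\<Sum>i\<in>A. \<Sum>j\<in>B. r i * s j * k i j)
      \<le> (norm (\<Sum>i\<in>A. r i *\<^sub>R ca i))\<^sup>2 + (norm (\<Sum>j\<in>B. s j *\<^sub>R cb j))\<^sup>2"
    if "A \<subseteq> I" "B \<subseteq> I" for A B r s
  proof -
    have "(norm (\<Sum>i\<in>A. r i *\<^sub>R ca i))\<^sup>2
        = (\<Sum>i\<in>A. \<Sum>j\<in>A. ((r i *\<^sub>R fst i) \<bullet> (r j *\<^sub>R fst j)) * min (p (snd i)) (p (snd j)))"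
      unfolding power2_norm_eq_inner inner_sum_left inner_sum_right using that(1)
      by (subst sum.swap) (auto intro!: sum.cong simp: gram_ca subset_iff)
    moreover have "(norm (\<Sum>i\<in>B. s i *\<^sub>R cb i))\<^sup>2
        = (\<Sum>i\<in>B. \<Sum>j\<in>B. ((s i *\<^sub>R fst i) \<bullet> (s j *\<^sub>R fst j)) * min (q (snd i)) (q (snd j)))"
      unfolding power2_norm_eq_inner inner_sum_left inner_sum_right using that(2)
      by (subst sum.swap) (auto intro!: sum.cong simp: gram_cb subset_iff)
    moreover have "(\<Sum>i\<in>A. \<Sum>j\<in>B. r i * s j * k i j)
        = (\<Sum>i\<in>A. \<Sum>j\<in>B. ((r i *\<^sub>R fst i) \<bullet> (s j *\<^sub>R fst j)) * min (p (snd i)) (q (snd j)))"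
      by (simp add: k_def mult_ac)
    ultimately show ?thesis
      using min_kernel_bound[of A "\<lambda>i. p (snd i)" B "\<lambda>i. q (snd i)"
          "\<lambda>i. r i *\<^sub>R fst i" "\<lambda>i. s i *\<^sub>R fst i"]
      by (simp add: p_def q_def)
  qed
  obtain T where lin: "bounded_linear T" and contr: "\<And>u. norm (T u) \<le> norm u"
    and pairing: "\<And>i j. i \<in> I \<Longrightarrow> j \<in> I \<Longrightarrow> T (ca i) \<bullet> cb j = k i j"
    and range: "\<And>u. T u \<in> closure (span (cb ` I))"
    and perp: "\<And>u. (\<And>i. i \<in> I \<Longrightarrow> u \<bullet> ca i = 0) \<Longrightarrow> T u = 0"
    using operator_of_kernel[of I I k ca cb] bound by blast
  interpret T: bounded_linear T by (rule lin)
  have pair: "T (c *\<^sub>C a E) \<bullet> (d *\<^sub>C b F) = (c \<bullet> d) * min (p E) (q F)"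
    if "E \<in> N" "F \<in> N" for c d E F
    using pairing[of "(c, E)" "(d, F)"] that by (simp add: I_def k_def ca_def cb_def)
  have perp': "T u = 0" if "\<And>c E. E \<in> N \<Longrightarrow> u \<bullet> (c *\<^sub>C a E) = 0" for u
    using that by (intro perp) (auto simp: ca_def I_def)

  \<comment> \<open>The kernel \<open>\<langle>c, d\<rangle>\<close> on scalars is compatible with complex multiplication, hence so is \<open>T\<close>.\<close>
  have homogeneous: "T (g *\<^sub>C u) = g *\<^sub>C T u" for g u
  proof -
    have "T (g *\<^sub>C u) - g *\<^sub>C T u = 0"
    proof (rule operator_zero_if_matrix_zero[where A = "ca ` I" and B = "cb ` I" and D = "\<lambda>u. T (g *\<^sub>C u) - g *\<^sub>C T u"])
      show "bounded_linear (\<lambda>u. T (g *\<^sub>C u) - g *\<^sub>C T u)"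
        by (intro bounded_linear_sub bounded_linear_compose[OF lin]
            bounded_linear_compose[OF bounded_linear_scaleC_right lin] bounded_linear_scaleC_right)
    next
      fix u assume u: "\<And>v. v \<in> ca ` I \<Longrightarrow> u \<bullet> v = 0"
      have "T u = 0"
        by (rule perp') (intro u ca_mem)
      moreover have "T (g *\<^sub>C u) = 0"
        by (rule perp') (simp add: inner_scaleC_left scaleC_scaleC u ca_mem)
      ultimately show "T (g *\<^sub>C u) - g *\<^sub>C T u = 0"
        by (simp add: scaleC_zero_right)
    next
      fix u
      have "g *\<^sub>C T u \<in> closure (span (cb ` I))"
        by (rule closed_span_invariant[OF bounded_linear_scaleC_right _ range], rule span_base)
          (auto simp: cb_def scaleC_scaleC I_def cb_mem[unfolded cb_def I_def])
      then show "T (g *\<^sub>C u) - g *\<^sub>C T u \<in> closure (span (cb ` I))"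
        by (intro subspace_diff subspace_closed_span range)
    next
      fix u v assume "u \<in> ca ` I" "v \<in> cb ` I"
      then obtain c E d F where *: "E \<in> N" "F \<in> N" "u = c *\<^sub>C a E" "v = d *\<^sub>C b F"
        by (auto simp: ca_def cb_def I_def)
      show "(T (g *\<^sub>C u) - g *\<^sub>C T u) \<bullet> v = 0"
        unfolding *(3,4) inner_diff_left inner_scaleC_left scaleC_scaleC pair[OF *(1,2)]
        by (simp add: inner_complex_def algebra_simps)
    qed
    then show ?thesis by simp
  qed

  \<comment> \<open>All \<open>\<parallel>b\<^sub>F\<parallel>\<close> are at most \<open>\<parallel>y\<parallel> \<le> \<parallel>x\<parallel>\<close>, so \<open>T x\<close> and \<open>y\<close> have the same pairings with the \<open>b\<^sub>F\<close>.\<close>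
  have interpolates: "T x = y"
  proof -
    have "y \<in> cb ` I"
      using cb_mem[OF bot(1), of 1] by (simp add: b_bot scaleC_one)
    then have y: "y \<in> closure (span (cb ` I))"
      by (rule subsetD[OF closure_subset, OF span_base])
    have "T x - y = 0"
    proof (rule closed_span_zero)
      show "T x - y \<in> closure (span (cb ` I))"
        by (intro subspace_diff subspace_closed_span range y)
      fix v assume "v \<in> cb ` I"
      then obtain d F where *: "F \<in> N" "v = d *\<^sub>C b F"
        by (auto simp: cb_def I_def)
      have "T x \<bullet> v = (1 \<bullet> d) * min (p e) (q F)"
        using pair[OF bot(1) *(1), of 1 d] by (simp add: * a_bot scaleC_one)
      moreover have "y \<bullet> v = (1 \<bullet> d) * min (q e) (q F)"
        using inner_scaleC_of_real_cinner[OF gram_b[OF bot(1) *(1)], of 1 d] by (simp add: * b_bot scaleC_one)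
      moreover have "q F \<le> q e" "q e \<le> p e"
        using b(3)[OF bot(1) *(1) bot_le[OF *(1)]] qp[OF bot(1)] by auto
      ultimately show "(T x - y) \<bullet> v = 0"
        by (simp add: inner_diff_left min_def)
    qed
    then show ?thesis by simp
  qed

  have triangular: "T (P E u) - Q E (T (P E u)) = 0" if E: "E \<in> N" for E u
  proof (rule operator_zero_if_matrix_zero[where A = "ca ` I" and B = "cb ` I" and D = "\<lambda>u. T (P E u) - Q E (T (P E u))"])
    note PE = P[OF E] and QE = Q[OF E]
    have TP: "bounded_linear (\<lambda>u. T (P E u))"
      by (rule bounded_linear_compose[OF lin proj_bounded_linear[OF PE]])
    then show "bounded_linear (\<lambda>u. T (P E u) - Q E (T (P E u)))"
      by (intro bounded_linear_sub bounded_linear_compose[OF proj_bounded_linear[OF QE]])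
    fix u
    {
      assume u: "\<And>v. v \<in> ca ` I \<Longrightarrow> u \<bullet> v = 0"
      have "P E u \<bullet> (c *\<^sub>C a G) = 0" if G: "G \<in> N" for c G
        using total[OF E G]
      proof
        assume "le E G"
        then show ?thesis
          by (simp add: proj_inner[OF PE] proj_scaleC[OF PE] a E G scaleC_zero_right)
      next
        assume "le G E"
        then show ?thesis
          by (simp add: proj_inner[OF PE] proj_scaleC[OF PE] a E G scaleC_diff_right inner_diff_right u ca_mem)
      qed
      then have "T (P E u) = 0" by (rule perp')
      then show "T (P E u) - Q E (T (P E u)) = 0"
        by (simp add: proj_0[OF QE])
    }
    have "Q E (T (P E u)) \<in> closure (span (cb ` I))"
    proof (rule closed_span_invariant[OF proj_bounded_linear[OF QE] _ range])
      fix v assume "v \<in> cb ` I"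
      then obtain d F where *: "F \<in> N" "v = d *\<^sub>C b F"
        by (auto simp: cb_def I_def)
      from total[OF E *(1)] show "Q E v \<in> span (cb ` I)"
      proof
        assume "le E F"
        then show ?thesis
          by (simp add: * proj_scaleC[OF QE] b E scaleC_zero_right span_zero)
      next
        assume "le F E"
        then show ?thesis
          by (simp add: * proj_scaleC[OF QE] b E scaleC_diff_right span_diff span_base cb_mem)
      qed
    qed
    then show "T (P E u) - Q E (T (P E u)) \<in> closure (span (cb ` I))"
      by (intro subspace_diff subspace_closed_span range)
    fix v assume "u \<in> ca ` I" "v \<in> cb ` I"
    then obtain c G d F where *: "G \<in> N" "F \<in> N" "u = c *\<^sub>C a G" "v = d *\<^sub>C b F"
      by (auto simp: ca_def cb_def I_def)
    from total[OF E *(1)] show "(T (P E u) - Q E (T (P E u))) \<bullet> v = 0"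
    proof
      assume "le E G"
      then have "P E u = 0"
        by (simp add: * proj_scaleC[OF PE] a E scaleC_zero_right)
      then show ?thesis
        by (simp add: T.zero proj_0[OF QE])
    next
      assume GE: "le G E"
      have PEu: "P E u = c *\<^sub>C a G - c *\<^sub>C a E"
        using GE by (simp add: * proj_scaleC[OF PE] a E scaleC_diff_right)
      have flat: "T (P E u) \<bullet> (d *\<^sub>C b F') = 0" if F': "F' \<in> N" "le E F'" for F'
      proof -
        have "q F' \<le> p E" "p E \<le> p G"
          using qp[OF F'(1)] a(3)[OF E F'] a(3)[OF *(1) E GE] by auto
        then show ?thesis
          unfolding PEu by (simp add: T.diff inner_diff_left pair E *(1) F'(1) min_def)
      qed
      have res: "(T (P E u) - Q E (T (P E u))) \<bullet> v = T (P E u) \<bullet> (v - Q E v)"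
        by (simp add: inner_diff_left inner_diff_right proj_inner[OF QE])
      from total[OF E *(2)] show ?thesis
      proof
        assume "le E F"
        then have "v - Q E v = d *\<^sub>C b F"
          by (simp add: * proj_scaleC[OF QE] b E scaleC_zero_right)
        then show ?thesis
          unfolding res using flat * \<open>le E F\<close> by simp
      next
        assume "le F E"
        then have "v - Q E v = d *\<^sub>C b E"
          by (simp add: * proj_scaleC[OF QE] b E scaleC_diff_right)
        moreover have "le E E"
          by (simp add: le_def proj_le_def proj_idem PE QE)
        ultimately show ?thesis
          unfolding res using flat E by simp
      qed
    qed
  qed
  show thesis
    by (rule that[OF _ contr interpolates triangular])
      (simp add: bounded_operators_def lin homogeneous)
qed

section \<open>Initial and final projections of partial isometries\<close>

lemma partial_isometry_bounded_operator: "partial_isometry V \<Longrightarrow> V \<in> bounded_operators"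
  by (simp add: partial_isometry_def)

lemma initial_proj_initial_space:
  assumes V: "partial_isometry V"
  shows "initial_proj V v \<in> initial_space V" "norm (V (initial_proj V v)) = norm (initial_proj V v)"
proof -
  have "cinner (cadjoint V (V v)) s = 0" if "V s = 0" for s
    using cadjoint[OF partial_isometry_bounded_operator[OF V], of s "V v"] that
      cinner_commute[of "cadjoint V (V v)" s]
    by (simp add: cinner_zero_left)
  then show "initial_proj V v \<in> initial_space V"
    by (simp add: initial_proj_def initial_space_def corthogonal_comp_def)
  then show "norm (V (initial_proj V v)) = norm (initial_proj V v)"
    using V by (simp add: partial_isometry_def)
qed

text \<open>
  By polarisation \<open>V\<close> preserves inner products on the initial space, so \<open>V\<^sup>*V v - v\<close> is
  orthogonal to that space; it also belongs to it, because the range of \<open>V\<^sup>*\<close> does.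
\<close>
lemma initial_proj_fixes_initial_space:
  assumes V: "partial_isometry V" and v: "v \<in> initial_space V"
  shows "initial_proj V v = v"
proof -
  note VB = partial_isometry_bounded_operator[OF V]
  interpret bounded_linear V using VB by (rule bounded_operatorsD)
  have add_mem: "u + w \<in> initial_space V" if "u \<in> initial_space V" "w \<in> initial_space V" for u w
    using that by (simp add: initial_space_def corthogonal_comp_def cinner_add_left)
  have diff_mem: "u - w \<in> initial_space V" if "u \<in> initial_space V" "w \<in> initial_space V" for u w
    using that by (simp add: initial_space_def corthogonal_comp_def cinner_diff_left)
  have iso: "norm (V u) = norm u" if "u \<in> initial_space V" for u
    using V that by (simp add: partial_isometry_def)
  define w where "w = initial_proj V v - v"
  have w: "w \<in> initial_space V"
    unfolding w_def using initial_proj_initial_space(1)[OF V] v by (rule diff_mem)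
  have "V v \<bullet> V w = v \<bullet> w"
    using iso[OF add_mem[OF v w]] iso[OF v] iso[OF w] dot_norm[of v w] dot_norm[of "V v" "V w"]
    by (simp add: add)
  moreover have "initial_proj V v \<bullet> w = V v \<bullet> V w"
  proof -
    have "w \<bullet> initial_proj V v = V w \<bullet> V v"
      by (simp add: inner_eq_Re_cinner initial_proj_def cadjoint[OF VB])
    then show ?thesis by (simp add: inner_commute)
  qed
  ultimately have "w \<bullet> w = 0"
    by (simp add: w_def inner_diff_left)
  then show ?thesis
    by (simp add: w_def)
qed

lemma cadjoint_bounded_operator:
  assumes T: "T \<in> bounded_operators"
  shows "cadjoint T \<in> bounded_operators"
proof -
  interpret T: bounded_linear T using T by (rule bounded_operatorsD)
  note adj = cadjoint[OF T, symmetric]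
  have "cadjoint T (c *\<^sub>C v) = c *\<^sub>C cadjoint T v" for c v
    by (rule cinner_ext) (simp add: adj cinner_scaleC_right)
  moreover have "bounded_linear (cadjoint T)"
  proof (rule bounded_linear_intro)
    show "cadjoint T (u + v) = cadjoint T u + cadjoint T v" for u v
      by (rule cinner_ext) (simp add: adj cinner_add_right)
    show "cadjoint T (r *\<^sub>R v) = r *\<^sub>R cadjoint T v" for r v
      by (rule cinner_ext) (simp add: adj scaleC_of_real[symmetric] cinner_scaleC_right)
    fix v
    have "(norm (cadjoint T v))\<^sup>2 = T (cadjoint T v) \<bullet> v"
      by (simp add: power2_norm_eq_inner inner_eq_Re_cinner cadjoint[OF T])
    also have "\<dots> \<le> norm (T (cadjoint T v)) * norm v"
      by (rule norm_cauchy_schwarz)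
    also have "\<dots> \<le> (onorm T * norm (cadjoint T v)) * norm v"
      by (intro mult_right_mono onorm T.bounded_linear_axioms norm_ge_zero)
    finally have *: "norm (cadjoint T v) * norm (cadjoint T v) \<le> (norm v * onorm T) * norm (cadjoint T v)"
      by (simp add: power2_eq_square mult_ac)
    show "norm (cadjoint T v) \<le> norm v * onorm T"
    proof (cases "cadjoint T v = 0")
      case True
      then show ?thesis
        by (simp add: onorm_pos_le T.bounded_linear_axioms)
    next
      case False
      then show ?thesis using * mult_le_cancel_right_pos by simp
    qed
  qed
  ultimately show ?thesis by (simp add: bounded_operators_def)
qed

lemma bounded_operators_comp:
  assumes "S \<in> bounded_operators" "T \<in> bounded_operators"
  shows "S \<circ> T \<in> bounded_operators"
  using assms bounded_linear_compose[of S T] by (auto simp: bounded_operators_def o_def)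

text \<open>
  The vector \<open>w = v - V\<^sup>*V v\<close> is annihilated by \<open>V\<^sup>*V\<close>, hence \<open>\<parallel>V w\<parallel>\<^sup>2 = \<langle>w, V\<^sup>*V w\<rangle> = 0\<close>.
\<close>
lemma partial_isometry_initial_proj:
  assumes V: "partial_isometry V"
  shows "V (initial_proj V v) = V v"
proof -
  note VB = partial_isometry_bounded_operator[OF V]
  interpret bounded_linear V using VB by (rule bounded_operatorsD)
  interpret A: bounded_linear "cadjoint V" using cadjoint_bounded_operator[OF VB] by (rule bounded_operatorsD)
  define w where "w = v - initial_proj V v"
  have "cadjoint V (V w) = 0"
    using initial_proj_fixes_initial_space[OF V initial_proj_initial_space(1)[OF V], of v]
    by (simp add: w_def initial_proj_def diff A.diff)
  then have "cinner (V w) (V w) = 0"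
    by (simp add: cadjoint[OF VB] cinner_zero_right)
  then show ?thesis
    by (simp add: cinner_self w_def diff)
qed

lemma initial_proj_orthogonal_projection:
  assumes V: "partial_isometry V"
  shows "orthogonal_projection (initial_proj V)"
proof -
  note VB = partial_isometry_bounded_operator[OF V]
  have "cinner (initial_proj V v) w = cinner v (initial_proj V w)" for v w
    using cadjoint[OF VB, of v "V w"] cadjoint[OF VB, of w "V v"]
      cinner_commute[of "V v" "V w"] cinner_commute[of "cadjoint V (V v)" w]
    by (simp add: initial_proj_def)
  moreover have "initial_proj V \<in> bounded_operators"
    unfolding initial_proj_def by (intro bounded_operators_comp cadjoint_bounded_operator VB)
  ultimately show ?thesis
    using initial_proj_fixes_initial_space[OF V] initial_proj_initial_space(1)[OF V]
    by (simp add: orthogonal_projection_def)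
qed

lemma final_proj_fixes_range:
  assumes V: "partial_isometry V"
  shows "final_proj V (V v) = V v"
  using partial_isometry_initial_proj[OF V] by (simp add: final_proj_def initial_proj_def)

lemma final_proj_orthogonal_projection:
  assumes V: "partial_isometry V"
  shows "orthogonal_projection (final_proj V)"
proof -
  note VB = partial_isometry_bounded_operator[OF V]
  have "cinner (final_proj V v) w = cinner v (final_proj V w)" for v w
    using cadjoint[OF VB, of "cadjoint V v" w] cadjoint[OF VB, of "cadjoint V w" v]
      cinner_commute[of "cadjoint V v" "cadjoint V w"] cinner_commute[of v "V (cadjoint V w)"]
    by (simp add: final_proj_def)
  moreover have "final_proj V \<in> bounded_operators"
    unfolding final_proj_def by (intro bounded_operators_comp cadjoint_bounded_operator VB)
  moreover have "final_proj V (final_proj V v) = final_proj V v" for v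
    using final_proj_fixes_range[OF V, of "cadjoint V v"] by (simp add: final_proj_def)
  ultimately show ?thesis
    by (simp add: orthogonal_projection_def)
qed

text \<open>
  On the range of \<open>P\<^sub>E\<close> the operator \<open>F\<close> agrees with \<open>E\<close> and is therefore isometric. Since
  \<open>\<parallel>F w\<parallel> = \<parallel>P\<^sub>F w\<parallel>\<close>, the projection \<open>P\<^sub>F\<close> preserves the norm of these vectors and so fixes
  them. The range of \<open>E\<close> lies in the range of \<open>F\<close> for the same reason, which orders the final
  projections.
\<close>
lemma hm_le_proj_le:
  assumes E: "partial_isometry E" and F: "partial_isometry F" and le: "hm_le E F"
  shows "proj_le (initial_proj E) (initial_proj F)" "proj_le (final_proj E) (final_proj F)"
proof -
  have FE: "F (initial_proj E v) = E (initial_proj E v)" for v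
    using le initial_proj_initial_space(1)[OF E] by (simp add: hm_le_def)
  have "initial_proj F (initial_proj E v) = initial_proj E v" for v
  proof (rule proj_fixed_if_norm_eq[OF initial_proj_orthogonal_projection[OF F]])
    have "norm (initial_proj F (initial_proj E v)) = norm (F (initial_proj E v))"
      using initial_proj_initial_space(2)[OF F] partial_isometry_initial_proj[OF F] by metis
    also have "\<dots> = norm (initial_proj E v)"
      by (simp add: FE initial_proj_initial_space(2)[OF E])
    finally show "norm (initial_proj F (initial_proj E v)) = norm (initial_proj E v)" .
  qed
  then show "proj_le (initial_proj E) (initial_proj F)"
    by (simp add: proj_le_def)
  have "final_proj E v = F (initial_proj E (cadjoint E v))" for v
    by (simp add: FE partial_isometry_initial_proj[OF E]) (simp add: final_proj_def)
  then show "proj_le (final_proj E) (final_proj F)"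
    by (simp add: proj_le_def final_proj_fixes_range[OF F])
qed

section \<open>The interpolation theorem\<close>

lemma ext_quotient_nonneg: "0 \<le> a \<Longrightarrow> 0 \<le> b \<Longrightarrow> 0 \<le> ext_quotient a b"
  by (simp add: ext_quotient_def)

lemma ext_quotient_le_iff:
  assumes "0 \<le> k" "0 \<le> a" "0 \<le> b"
  shows "ext_quotient a b \<le> ereal k \<longleftrightarrow> a \<le> k * b"
  using assms by (cases "b = 0") (auto simp: ext_quotient_def divide_le_eq)

text \<open>
  The component of \<open>S x\<close> outside the range of \<open>Q\<close> depends only on \<open>x - P x\<close>, since \<open>S P x\<close> lies
  in that range.
\<close>
lemma tail_estimate:
  assumes P: "orthogonal_projection P" and Q: "orthogonal_projection Q" and S: "bounded_linear S"
    and tri: "\<And>v. S (P v) - Q (S (P v)) = 0"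
  shows "norm (S x - Q (S x)) \<le> onorm S * norm (x - P x)"
proof -
  interpret S: bounded_linear S by fact
  have "S x - Q (S x) = S (x - P x) - Q (S (x - P x))"
    using tri[of x] by (simp add: S.diff proj_diff[OF Q] algebra_simps)
  then have "norm (S x - Q (S x)) \<le> norm (S (x - P x))"
    using norm_residual_le[OF Q] by simp
  also have "\<dots> \<le> onorm S * norm (x - P x)"
    by (rule onorm[OF S])
  finally show ?thesis .
qed

lemma proj_zero:
  fixes Z :: "'a::complex_hilbert_space \<Rightarrow> 'a"
  defines "Z \<equiv> \<lambda>_. 0"
  shows "initial_proj Z v = 0" "final_proj Z v = 0"
proof -
  have "cadjoint Z = Z"
    unfolding Z_def
    by (rule cadjoint_eqI) (simp add: cinner_zero_left cinner_zero_right)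
  then show "initial_proj Z v = 0" "final_proj Z v = 0"
    by (simp_all add: initial_proj_def final_proj_def Z_def)
qed

theorem theorem4p3:
  fixes \<E> :: "('a::complex_hilbert_space \<Rightarrow> 'a) set"
    and x y :: 'a
    and K :: ereal
  assumes "complete_family \<E>"
    and "totally_ordered_family \<E>"
    and "\<exists>E0\<in>\<E>. x \<in> range (initial_proj E0)"
    and "\<exists>F0\<in>\<E>. y \<in> range (final_proj F0)"
    and K_def: "K = (SUP E\<in>\<E>. ext_quotient (norm (y - final_proj E y)) (norm (x - initial_proj E x)))"
  shows "((\<exists>T\<in>family_operators \<E>. T x = y) \<longleftrightarrow> K < \<infinity>)
    \<and> (K < \<infinity> \<longrightarrow> (\<exists>T\<in>family_operators \<E>. T x = y \<and> ereal (onorm T) = K))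
    \<and> (\<forall>S\<in>family_operators \<E>. S x = y \<longrightarrow> ereal (onorm S) \<ge> K)"
proof -
  have zero: "(\<lambda>_. 0) \<in> \<E>" and piso: "\<And>E. E \<in> \<E> \<Longrightarrow> partial_isometry E"
    using \<open>complete_family \<E>\<close> by (auto simp: complete_family_def)
  note P = initial_proj_orthogonal_projection[OF piso] and Q = final_proj_orthogonal_projection[OF piso]
  have lower: "K \<le> ereal (onorm S)" if S: "S \<in> family_operators \<E>" and "S x = y" for S
    unfolding K_def
  proof (rule SUP_least)
    fix E assume E: "E \<in> \<E>"
    have lin: "bounded_linear S"
      using S by (simp add: family_operators_def bounded_operators_def)
    have "norm (y - final_proj E y) \<le> onorm S * norm (x - initial_proj E x)"
      unfolding \<open>S x = y\<close>[symmetric] using S E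
      by (intro tail_estimate P Q lin) (auto simp: family_operators_def)
    then show "ext_quotient (norm (y - final_proj E y)) (norm (x - initial_proj E x)) \<le> ereal (onorm S)"
      by (simp add: ext_quotient_le_iff onorm_pos_le[OF lin])
  qed
  have attained: "\<exists>T\<in>family_operators \<E>. T x = y \<and> ereal (onorm T) = K" if "K < \<infinity>"
  proof -
    have "0 \<le> ext_quotient (norm (y - final_proj (\<lambda>_. 0) y)) (norm (x - initial_proj (\<lambda>_. 0) x))"
      by (simp add: ext_quotient_nonneg)
    also have "\<dots> \<le> K"
      unfolding K_def using zero by (rule SUP_upper)
    finally obtain k where k: "K = ereal k" "0 \<le> k"
      using \<open>K < \<infinity>\<close> by (cases K) auto
    \<comment> \<open>Interpolating \<open>k x \<mapsto> y\<close> by a contraction and multiplying the operator by \<open>k\<close> also covers \<open>k = 0\<close>, where \<open>y = 0\<close>.\<close>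
    have tails: "norm (y - final_proj E y) \<le> norm (k *\<^sub>R x - initial_proj E (k *\<^sub>R x))" if E: "E \<in> \<E>" for E
    proof -
      have "ext_quotient (norm (y - final_proj E y)) (norm (x - initial_proj E x)) \<le> ereal k"
        unfolding k(1)[symmetric] K_def using E by (rule SUP_upper)
      then have "norm (y - final_proj E y) \<le> k * norm (x - initial_proj E x)"
        by (simp add: ext_quotient_le_iff k(2))
      also have "\<dots> = norm (k *\<^sub>R (x - initial_proj E x))"
        using k(2) by simp
      also have "k *\<^sub>R (x - initial_proj E x) = k *\<^sub>R x - initial_proj E (k *\<^sub>R x)"
        by (simp add: scaleR_diff_right proj_scaleR[OF P[OF E]])
      finally show ?thesis .
    qed
    obtain T where T: "T \<in> bounded_operators" and contr: "\<And>u. norm (T u) \<le> norm u"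
      and Tx: "T (k *\<^sub>R x) = y"
      and tri: "\<And>E v. E \<in> \<E> \<Longrightarrow> T (initial_proj E v) - final_proj E (T (initial_proj E v)) = 0"
    proof (rule contractive_interpolation[where N = \<E> and P = initial_proj and Q = final_proj
          and e = "\<lambda>_. 0" and x = "k *\<^sub>R x" and y = y])
      fix E F assume "E \<in> \<E>" "F \<in> \<E>"
      then show "proj_le (initial_proj E) (initial_proj F) \<and> proj_le (final_proj E) (final_proj F)
          \<or> proj_le (initial_proj F) (initial_proj E) \<and> proj_le (final_proj F) (final_proj E)"
        using \<open>totally_ordered_family \<E>\<close> hm_le_proj_le piso unfolding totally_ordered_family_def by metis
    qed (use P Q zero tails in \<open>auto simp: proj_zero\<close>)
    interpret T: bounded_linear T using T by (rule bounded_operatorsD)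
    define S where "S u = k *\<^sub>R T u" for u
    have "S \<in> bounded_operators"
      using T unfolding S_def bounded_operators_def
      by (auto simp: scaleC_scaleR_commute intro: bounded_linear_compose[OF bounded_linear_scaleR_right])
    moreover have "S (initial_proj E v) - final_proj E (S (initial_proj E v)) = 0" if E: "E \<in> \<E>" for E v
    proof -
      have "S (initial_proj E v) - final_proj E (S (initial_proj E v))
          = k *\<^sub>R (T (initial_proj E v) - final_proj E (T (initial_proj E v)))"
        by (simp add: S_def scaleR_diff_right proj_scaleR[OF Q[OF E]])
      then show ?thesis by (simp add: tri[OF E])
    qed
    ultimately have mem: "S \<in> family_operators \<E>"
      by (simp add: family_operators_def)
    have Sx: "S x = y"
      using Tx by (simp add: S_def T.scaleR)
    have "onorm S \<le> k"
      using contr k(2) by (intro onorm_bound) (simp_all add: S_def mult_left_mono)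
    then have "ereal (onorm S) = K"
      using lower[OF mem Sx] k(1) by simp
    then show ?thesis using mem Sx by blast
  qed
  have "K < \<infinity>" if "T \<in> family_operators \<E>" "T x = y" for T
    using lower[OF that] by (rule order_le_less_trans) simp
  then show ?thesis
    using lower attained by blast
qed

end
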